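(* Let $A$ be a densely defined closed linear operator in an infinite-dimensional separable Banach space $(X,\|\cdot\|)$ over $\mathbb F$ ($\mathbb F=\mathbb R$ or $\mathbb F=\mathbb C$), and let $A^*$ be its adjoint, acting in the dual space $X^*$. If $A$ is hypercyclic, then each of the following statements holds. (1) For each nonzero $g^*\in\bigcap_{n=1}^\infty D\left((A^* )^n\right)$, the orbit $\{(A^* )^ng^*\}_{n\ge 0}$ of $g^*$ under $A^*$ is unbounded. (2) The adjoint operator $A^*$ has no eigenvalues; i.e., $\sigma_p(A^* )=\emptyset$ provided the underlying space is complex. (3) For every $\lambda\in\mathbb F$: $\overline{R(A-\lambda I)}=X$. (4) $\sigma_r(A)=\emptyset$ provided the underlying space is complex.
   Context: Operators may be unbounded; $D(\cdot)$ and $R(\cdot)$ denote the domain and range of an operator, $I$ is the identity operator, and $\overline{\,\cdot\,}$ is closure. A linear operator $A$ in a Banach space $X$ is called hypercyclic if there is a nonzero vector $f\in\bigcap_{n=0}^\infty D(A^n)$ (with $A^0:=I$) whose orbit $\{A^nf\}_{n\ge 0}$ is dense in $X$. For a closed linear operator $T$ in a complex Banach space, the point spectrum $\sigma_p(T)$ is the set of $\lambda\in\mathbb C$ for which $T-\lambda I$ is not injective (i.e., the eigenvalues of $T$), and the residual spectrum $\sigma_r(T)$ is the set of $\lambda\in\mathbb C$ for which $T-\lambda I$ is injective and $R(T-\lambda I)$ is not dense. *)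

theory Defs
  imports "HOL-Analysis.Analysis"
begin

text \<open>
  The library has no class of complex normed spaces. A normed space over the scalar field
  \<open>'f\<close> (real or complex numbers) is therefore a real normed space together with a scalar
  multiplication by \<open>'f\<close> that extends the real one and is compatible with the norm. Completeness
  does not depend on the scalars and is expressed by the type class \<open>banach\<close>.
  For real scalars the second assumption forces \<open>smul\<close> to be \<open>scaleR\<close>.
\<close>

locale normed_space_over = vector_space smul
  for smul :: "'f::real_normed_field \<Rightarrow> 'x::real_normed_vector \<Rightarrow> 'x" +
  assumes norm_scale: "norm (smul c x) = norm c * norm x"
    and scale_of_real: "smul (of_real r) x = r *\<^sub>R x"

lemma normed_space_over_scaleR:
  "normed_space_over (scaleR :: real \<Rightarrow> 'x::real_normed_vector \<Rightarrow> 'x)"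
  by unfold_locales (simp_all add: algebra_simps)

definition infinite_dimensional :: "('f::field \<Rightarrow> 'x::ab_group_add \<Rightarrow> 'x) \<Rightarrow> bool" where
  "infinite_dimensional smul \<longleftrightarrow> \<not> (\<exists>S. finite S \<and> module.span smul S = UNIV)"

text \<open>
  An operator in \<open>'x\<close> that need not be everywhere defined is a partial map \<open>A :: 'x \<rightharpoonup> 'x\<close>:
  its domain is \<open>dom A\<close>, its range \<open>ran A\<close> and its graph \<open>Map.graph A\<close>.
\<close>

definition linear_operator :: "('f::field \<Rightarrow> 'x::ab_group_add \<Rightarrow> 'x) \<Rightarrow> ('x \<rightharpoonup> 'x) \<Rightarrow> bool" where
  "linear_operator smul A \<longleftrightarrow>
     A 0 = Some 0 \<and>
     (\<forall>x y u v. A x = Some u \<longrightarrow> A y = Some v \<longrightarrow> A (x + y) = Some (u + v)) \<and>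
     (\<forall>c x u. A x = Some u \<longrightarrow> A (smul c x) = Some (smul c u))"

definition densely_defined :: "('x::topological_space \<rightharpoonup> 'x) \<Rightarrow> bool" where
  "densely_defined A \<longleftrightarrow> closure (dom A) = UNIV"

definition closed_operator :: "('x::topological_space \<rightharpoonup> 'x) \<Rightarrow> bool" where
  "closed_operator A \<longleftrightarrow> closed (Map.graph A)"

text \<open>Powers carry their natural domain: \<open>x\<close> is in the domain of the power \<open>n + 1\<close> iff it is in
  the domain of the power \<open>n\<close>, whose value at \<open>x\<close> lies in the domain of \<open>A\<close>.\<close>

primrec op_power :: "('x \<rightharpoonup> 'x) \<Rightarrow> nat \<Rightarrow> ('x \<rightharpoonup> 'x)" where
  "op_power A 0 = Some"
| "op_power A (Suc n) = A \<circ>\<^sub>m op_power A n"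

definition op_orbit :: "('x \<rightharpoonup> 'x) \<Rightarrow> 'x \<Rightarrow> 'x set" where
  "op_orbit A x = {y. \<exists>n. op_power A n x = Some y}"

definition hypercyclic :: "('x::real_normed_vector \<rightharpoonup> 'x) \<Rightarrow> bool" where
  "hypercyclic A \<longleftrightarrow>
     (\<exists>f. f \<noteq> 0 \<and> f \<in> (\<Inter>n. dom (op_power A n)) \<and> closure (op_orbit A f) = UNIV)"

definition op_shift :: "('f \<Rightarrow> 'x::ab_group_add \<Rightarrow> 'x) \<Rightarrow> ('x \<rightharpoonup> 'x) \<Rightarrow> 'f \<Rightarrow> ('x \<rightharpoonup> 'x)" where
  "op_shift smul A l = (\<lambda>x. map_option (\<lambda>y. y - smul l x) (A x))"

definition eigenvalue :: "('f \<Rightarrow> 'x::ab_group_add \<Rightarrow> 'x) \<Rightarrow> ('x \<rightharpoonup> 'x) \<Rightarrow> 'f \<Rightarrow> bool" where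
  "eigenvalue smul A l \<longleftrightarrow> (\<exists>x. x \<noteq> 0 \<and> A x = Some (smul l x))"

definition point_spectrum ::
  "(complex \<Rightarrow> 'x::ab_group_add \<Rightarrow> 'x) \<Rightarrow> ('x \<rightharpoonup> 'x) \<Rightarrow> complex set" where
  "point_spectrum smul A = {l. \<not> inj_on (op_shift smul A l) (dom A)}"

definition residual_spectrum ::
  "(complex \<Rightarrow> 'x::real_normed_vector \<Rightarrow> 'x) \<Rightarrow> ('x \<rightharpoonup> 'x) \<Rightarrow> complex set" where
  "residual_spectrum smul A =
     {l. inj_on (op_shift smul A l) (dom A) \<and> closure (ran (op_shift smul A l)) \<noteq> UNIV}"

text \<open>
  The dual space consists of the bounded functionals that are linear over \<open>'f\<close>, as a subset of
  the type of bounded real-linear maps, whose norm is the operator norm. (For real scalars it is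
  the whole type.) Scalars act on it by \<open>(c g) x = c * g x\<close>.
\<close>

definition dual_space ::
  "('f::real_normed_field \<Rightarrow> 'x::real_normed_vector \<Rightarrow> 'x) \<Rightarrow> ('x \<Rightarrow>\<^sub>L 'f) set" where
  "dual_space smul = {g. \<forall>c x. blinfun_apply g (smul c x) = c * blinfun_apply g x}"

definition dual_scale ::
  "'f::real_normed_field \<Rightarrow> ('x::real_normed_vector \<Rightarrow>\<^sub>L 'f) \<Rightarrow> ('x \<Rightarrow>\<^sub>L 'f)" where
  "dual_scale c g = blinfun_mult_right c o\<^sub>L g"

text \<open>
  The functional \<open>h\<close> below is unique if \<open>A\<close> is densely defined; the definition is only meaningful
  in that case.
\<close>

definition is_adjoint_value ::
  "('f::real_normed_field \<Rightarrow> 'x::real_normed_vector \<Rightarrow> 'x) \<Rightarrow> ('x \<rightharpoonup> 'x) \<Rightarrow>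
     ('x \<Rightarrow>\<^sub>L 'f) \<Rightarrow> ('x \<Rightarrow>\<^sub>L 'f) \<Rightarrow> bool" where
  "is_adjoint_value smul A g h \<longleftrightarrow>
     g \<in> dual_space smul \<and> h \<in> dual_space smul \<and>
     (\<forall>x y. A x = Some y \<longrightarrow> blinfun_apply g y = blinfun_apply h x)"

definition adjoint_operator ::
  "('f::real_normed_field \<Rightarrow> 'x::real_normed_vector \<Rightarrow> 'x) \<Rightarrow> ('x \<rightharpoonup> 'x) \<Rightarrow>
     (('x \<Rightarrow>\<^sub>L 'f) \<rightharpoonup> ('x \<Rightarrow>\<^sub>L 'f))" where
  "adjoint_operator smul A g =
     (if \<exists>h. is_adjoint_value smul A g h
      then Some (THE h. is_adjoint_value smul A g h) else None)"

end

theory Submission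
  imports Defs
begin

text \<open>
  If a continuous absolutely homogeneous function \<open>p\<close> satisfies \<open>p (A x) = c * p x\<close>, then along an
  orbit it takes the values \<open>c ^ n * p f\<close>. These are bounded if \<open>c \<le> 1\<close> and bounded away from
  \<open>0\<close> (or all \<open>0\<close>) if \<open>c > 1\<close>, so a dense orbit forces \<open>p = 0\<close>.
  For \<open>p = norm \<circ> g\<close> with \<open>g\<close> an eigenvector of the adjoint this excludes eigenvalues of the adjoint.
  For \<open>p\<close> the distance to the range of \<open>A - l I\<close> it shows that this range is dense, without the
  Hahn-Banach theorem. A bounded orbit of the adjoint through \<open>g\<close> would bound \<open>g\<close> on the dense orbit of \<open>A\<close>.
\<close>

section \<open>Homogeneous functions along dense orbits, and powers of an operator\<close>

lemma closure_UNIV_closed_superset: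
  assumes "closure S = UNIV" "closed T" "S \<subseteq> T"
  shows "x \<in> T"
  using closure_minimal[OF assms(3,2)] assms(1) by auto

lemma bounded_homogeneous_eq_0:
  fixes p :: "'x::real_vector \<Rightarrow> real"
  assumes hom: "\<And>r x. p (r *\<^sub>R x) = \<bar>r\<bar> * p x"
    and nonneg: "\<And>x. p x \<ge> 0"
    and le: "\<And>x. p x \<le> K"
  shows "p x = 0"
proof (rule ccontr)
  assume "p x \<noteq> 0"
  with nonneg[of x] have pos: "p x > 0" by linarith
  have K: "K \<ge> 0" using nonneg[of x] le[of x] by linarith
  \<comment> \<open>The scalar is chosen so that the value overshoots the supposed bound
    \<open>K\<close> by exactly 1.\<close>
  have "p (((K + 1) / p x) *\<^sub>R x) = K + 1"
    using pos K by (simp add: hom)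
  with le[of "((K + 1) / p x) *\<^sub>R x"] show False by simp
qed

lemma op_power_scales:
  fixes p :: "'x \<Rightarrow> real"
  assumes "\<And>x y. A x = Some y \<Longrightarrow> p y = c * p x" and "op_power A n x = Some y"
  shows "p y = c ^ n * p x"
  using assms(2)
proof (induction n arbitrary: y)
  case (Suc n)
  then obtain z where "op_power A n x = Some z" "A z = Some y"
    by (auto simp: map_comp_Some_iff)
  with Suc.IH assms(1) show ?case by simp
qed simp

lemma dense_orbit_scaled_eq_0:
  fixes p :: "'x::real_normed_vector \<Rightarrow> real"
  assumes dense: "closure (op_orbit A f) = UNIV"
    and cont: "continuous_on UNIV p"
    and hom: "\<And>r x. p (r *\<^sub>R x) = \<bar>r\<bar> * p x"
    and nonneg: "\<And>x. p x \<ge> 0"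
    and "c \<ge> 0" and scaled: "\<And>x y. A x = Some y \<Longrightarrow> p y = c * p x"
  shows "p x = 0"
proof -
  have orbit: "\<exists>n. p y = c ^ n * p f" if "y \<in> op_orbit A f" for y
    using that op_power_scales[of A p c, OF scaled] unfolding op_orbit_def by blast
  have upper: "p x \<le> K" if "\<And>n. c ^ n * p f \<le> K" for x K
  proof -
    have "closed {x. p x \<le> K}"
      by (rule closed_Collect_le[OF cont continuous_on_const])
    moreover have "op_orbit A f \<subseteq> {x. p x \<le> K}"
      using orbit that by fastforce
    ultimately show ?thesis using closure_UNIV_closed_superset[OF dense] by blast
  qed
  have "\<exists>K. \<forall>n. c ^ n * p f \<le> K"
  proof (cases "c \<le> 1")
    case True
    then have "c ^ n * p f \<le> p f" for n
      using \<open>c \<ge> 0\<close> nonneg[of f] by (simp add: mult_left_le_one_le power_le_one)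
    then show ?thesis by blast
  next
    case False
    then have ge: "p f \<le> c ^ n * p f" for n
      using nonneg[of f] by (simp add: mult_le_cancel_right1 one_le_power)
    \<comment> \<open>The lower bound \<open>p f\<close> passes from the orbit to its closure, hence
      to the point 0, where \<open>p\<close> vanishes. So \<open>p f = 0\<close>, and the values
      along the orbit are bounded after all.\<close>
    have "closed {x. p f \<le> p x}"
      by (rule closed_Collect_le[OF continuous_on_const cont])
    moreover have "op_orbit A f \<subseteq> {x. p f \<le> p x}"
      using orbit ge by fastforce
    ultimately have "p f \<le> p 0" using closure_UNIV_closed_superset[OF dense] by blast
    moreover have "p 0 = 0" using hom[of 0 0] by simp
    ultimately have "p f = 0" using nonneg[of f] by simp
    then show ?thesis by auto
  qed
  then obtain K where "\<And>n. c ^ n * p f \<le> K" by blast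
  from bounded_homogeneous_eq_0[OF hom nonneg upper[OF this]] show ?thesis .
qed

text \<open>Associativity of partial composition. \<open>op_power\<close> peels off the outermost
  factor, but duality reverses the order of factors, so the innermost one must be accessible
  too.\<close>

lemma op_power_Suc_right: "op_power A (Suc n) x = Option.bind (A x) (op_power A n)"
proof (induction n)
  case 0
  show ?case by (cases "A x") simp_all
next
  case (Suc n)
  have "op_power A (Suc (Suc n)) x = Option.bind (op_power A (Suc n) x) A"
    by (simp add: map_comp_def split: option.split)
  also have "\<dots> = Option.bind (A x) (op_power A (Suc n))"
    by (subst Suc.IH) (cases "A x"; simp add: map_comp_def split: option.split)
  finally show ?case .
qed

section \<open>The adjoint, its powers and its eigenvalues\<close>

lemma dual_scale_apply [simp]: "blinfun_apply (dual_scale c g) x = c * blinfun_apply g x"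
  by (simp add: dual_scale_def)

text \<open>Both functionals are prescribed on the dense domain of \<open>A\<close>, and two
  continuous functionals agree on a closed set. This makes the definite description in
  \<open>adjoint_operator\<close> meaningful.\<close>

lemma is_adjoint_value_unique:
  assumes "densely_defined A" "is_adjoint_value smul A g h" "is_adjoint_value smul A g h'"
  shows "h = h'"
proof (rule blinfun_eqI)
  fix x
  have "closed {x. blinfun_apply h x = blinfun_apply h' x}"
    by (intro closed_Collect_eq continuous_intros)
  moreover have "dom A \<subseteq> {x. blinfun_apply h x = blinfun_apply h' x}"
    using assms(2,3) unfolding is_adjoint_value_def by auto
  ultimately show "blinfun_apply h x = blinfun_apply h' x"
    using closure_UNIV_closed_superset assms(1) unfolding densely_defined_def by blast
qed

lemma adjoint_operator_eq_Some_iff: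
  assumes "densely_defined A"
  shows "adjoint_operator smul A g = Some h \<longleftrightarrow> is_adjoint_value smul A g h"
proof -
  have "(THE h. is_adjoint_value smul A g h) = h'" if "is_adjoint_value smul A g h'" for h'
    using that is_adjoint_value_unique[OF assms _ that] by (rule the_equality)
  then show ?thesis unfolding adjoint_operator_def by (metis option.distinct(1) option.inject)
qed

lemma adjoint_op_power_apply:
  assumes dd: "densely_defined A"
    and "op_power (adjoint_operator smul A) n g = Some h" "op_power A n x = Some y"
  shows "blinfun_apply g y = blinfun_apply h x"
  using assms(2,3)
proof (induction n arbitrary: h x)
  case (Suc n)
  from Suc.prems(1) obtain h' where h': "op_power (adjoint_operator smul A) n g = Some h'"
    "is_adjoint_value smul A h' h"
    by (auto simp: map_comp_Some_iff adjoint_operator_eq_Some_iff[OF dd])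
  from Suc.prems(2) obtain z where z: "A x = Some z" "op_power A n z = Some y"
    unfolding op_power_Suc_right by (auto simp: bind_eq_Some_conv)
  \<comment> \<open>With \<open>h'\<close> the n-th adjoint power at \<open>g\<close> and
    \<open>z = A x\<close>, the induction hypothesis moves n factors across,
    \<open>g y = h' z\<close>, and the adjoint relation moves the last one,
    \<open>h' z = h x\<close>.\<close>
  show ?case
    using Suc.IH[OF h'(1) z(2)] h'(2) z(1) unfolding is_adjoint_value_def by simp
qed simp

lemma adjoint_orbit_unbounded:
  assumes dd: "densely_defined A" and "hypercyclic A"
    and g: "g \<in> (\<Inter>n\<in>{1..}. dom (op_power (adjoint_operator smul A) n))" "g \<noteq> 0"
  shows "\<not> bounded (op_orbit (adjoint_operator smul A) g)"
proof
  assume "bounded (op_orbit (adjoint_operator smul A) g)"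
  then obtain K where K: "\<And>h. h \<in> op_orbit (adjoint_operator smul A) g \<Longrightarrow> norm h \<le> K"
    unfolding bounded_iff by blast
  obtain f where f: "closure (op_orbit A f) = UNIV"
    using \<open>hypercyclic A\<close> unfolding hypercyclic_def by blast
  have orbit: "op_orbit A f \<subseteq> {x. norm (blinfun_apply g x) \<le> K * norm f}"
  proof
    fix y assume "y \<in> op_orbit A f"
    then obtain n where n: "op_power A n f = Some y" unfolding op_orbit_def by blast
    \<comment> \<open>The intersection starts at exponent 1; exponent 0 is the identity, which is
      defined everywhere.\<close>
    have "g \<in> dom (op_power (adjoint_operator smul A) n)"
      using g(1) by (cases n) (auto simp del: op_power.simps(2))
    then obtain h where h: "op_power (adjoint_operator smul A) n g = Some h" by blast
    \<comment> \<open>Here \<open>g y = h f\<close>: the n-th power of \<open>A\<close> at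
      \<open>f\<close> is traded for the n-th adjoint power at \<open>g\<close>, whose norm is at
      most \<open>K\<close>.\<close>
    have "norm (blinfun_apply g y) \<le> norm h * norm f"
      using norm_blinfun[of h f] adjoint_op_power_apply[OF dd h n] by simp
    also have "norm h \<le> K" using K h unfolding op_orbit_def by blast
    finally show "y \<in> {x. norm (blinfun_apply g x) \<le> K * norm f}"
      by (simp add: mult_right_mono)
  qed
  have "closed {x. norm (blinfun_apply g x) \<le> K * norm f}"
    by (intro closed_Collect_le continuous_intros)
  then have "norm (blinfun_apply g x) \<le> K * norm f" for x
    using closure_UNIV_closed_superset[OF f _ orbit] by blast
  then have "norm (blinfun_apply g x) = 0" for x
    by (intro bounded_homogeneous_eq_0[of "\<lambda>x. norm (blinfun_apply g x)"])
      (simp_all add: blinfun.scaleR_right)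
  then have "g = 0" by (intro blinfun_eqI) simp
  with g(2) show False ..
qed

lemma adjoint_no_eigenvalue:
  assumes dd: "densely_defined A" and "hypercyclic A"
  shows "\<not> eigenvalue dual_scale (adjoint_operator smul A) l"
proof
  assume "eigenvalue dual_scale (adjoint_operator smul A) l"
  then obtain g where "g \<noteq> 0" and g: "is_adjoint_value smul A g (dual_scale l g)"
    unfolding eigenvalue_def adjoint_operator_eq_Some_iff[OF dd] by blast
  obtain f where f: "closure (op_orbit A f) = UNIV"
    using \<open>hypercyclic A\<close> unfolding hypercyclic_def by blast
  have "norm (blinfun_apply g x) = 0" for x
  proof (rule dense_orbit_scaled_eq_0[OF f, where p = "\<lambda>x. norm (blinfun_apply g x)"
        and c = "norm l"])
    show "continuous_on UNIV (\<lambda>x. norm (blinfun_apply g x))"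
      by (intro continuous_intros)
    \<comment> \<open>Evaluating the eigenvector equation at \<open>x\<close> gives
      \<open>g y = l * g x\<close>.\<close>
    show "norm (blinfun_apply g y) = norm l * norm (blinfun_apply g x)"
      if "A x = Some y" for x y
      using that g unfolding is_adjoint_value_def by (simp add: norm_mult)
  qed (simp_all add: blinfun.scaleR_right)
  then have "g = 0" by (intro blinfun_eqI) simp
  with \<open>g \<noteq> 0\<close> show False ..
qed

lemma is_adjoint_value_diff:
  assumes "is_adjoint_value smul A g h" "is_adjoint_value smul A g' h'"
  shows "is_adjoint_value smul A (g - g') (h - h')"
proof -
  have "u - v \<in> dual_space smul" if "u \<in> dual_space smul" "v \<in> dual_space smul" for u v
    using that by (simp add: dual_space_def blinfun.diff_left right_diff_distrib)
  moreover have "blinfun_apply (g - g') y = blinfun_apply (h - h') x" if "A x = Some y" for x y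
    using assms that unfolding is_adjoint_value_def by (metis blinfun.diff_left)
  ultimately show ?thesis using assms unfolding is_adjoint_value_def by blast
qed

lemma dual_scale_diff: "dual_scale l (g - g') = dual_scale l g - dual_scale l g'"
  by (rule blinfun_eqI) (simp add: blinfun.diff_left algebra_simps)

text \<open>The point spectrum is defined by failure of injectivity. By linearity of the adjoint,
  the difference of two distinct points with the same image under the shifted adjoint is an
  eigenvector.\<close>

lemma adjoint_point_spectrum_subset:
  assumes dd: "densely_defined A"
  shows "point_spectrum dual_scale (adjoint_operator smul A) \<subseteq>
    {l. eigenvalue dual_scale (adjoint_operator smul A) l}"
proof safe
  fix l assume "l \<in> point_spectrum dual_scale (adjoint_operator smul A)"
  then obtain g g' h h' where "g \<noteq> g'"
    and val: "adjoint_operator smul A g = Some h" "adjoint_operator smul A g' = Some h'"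
    and eq: "op_shift dual_scale (adjoint_operator smul A) l g =
      op_shift dual_scale (adjoint_operator smul A) l g'"
    unfolding point_spectrum_def inj_on_def by blast
  from val have adj: "is_adjoint_value smul A g h" "is_adjoint_value smul A g' h'"
    unfolding adjoint_operator_eq_Some_iff[OF dd] .
  from eq have "h - dual_scale l g = h' - dual_scale l g'"
    by (simp add: op_shift_def val)
  then have "h - h' = dual_scale l (g - g')"
    by (simp add: dual_scale_diff algebra_simps)
  with is_adjoint_value_diff[OF adj] \<open>g \<noteq> g'\<close>
  show "eigenvalue dual_scale (adjoint_operator smul A) l"
    unfolding eigenvalue_def adjoint_operator_eq_Some_iff[OF dd]
    by (metis right_minus_eq)
qed

section \<open>Distance to a subspace and density of the range of \<open>A - l I\<close>\<close>

context normed_space_over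
begin

lemma infdist_subspace_scale:
  assumes "subspace R"
  shows "infdist (smul c x) R = norm c * infdist x R"
proof (cases "c = 0")
  case True
  then show ?thesis using subspace_0[OF assms] by simp
next
  case False
  have R: "R \<noteq> {}" using subspace_0[OF assms] by blast
  \<comment> \<open>Scaling a competitor \<open>a\<close> for \<open>y\<close> by \<open>d\<close>
    gives a competitor for \<open>smul d y\<close>, as \<open>R\<close> is a subspace. Only this
    inequality needs an argument: the reverse one follows by applying it to \<open>inverse c\<close>
    and \<open>smul c x\<close>.\<close>
  have le: "infdist (smul d y) R \<le> norm d * infdist y R" if "d \<noteq> 0" for d y
  proof -
    have "infdist (smul d y) R / norm d \<le> infdist y R"
      unfolding infdist_notempty[OF R, of y]
    proof (rule cINF_greatest[OF R])
      fix a assume "a \<in> R"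
      then have "infdist (smul d y) R \<le> dist (smul d y) (smul d a)"
        using subspace_scale[OF assms] by (intro infdist_le)
      also have "\<dots> = norm d * dist y a"
        by (simp add: dist_norm norm_scale flip: scale_right_diff_distrib)
      finally show "infdist (smul d y) R / norm d \<le> dist y a"
        using that by (simp add: divide_le_eq mult.commute)
    qed
    then show ?thesis using that by (simp add: divide_le_eq mult.commute)
  qed
  have "infdist x R \<le> infdist (smul c x) R / norm c"
    using le[of "inverse c" "smul c x"] False
    by (simp add: norm_inverse divide_inverse mult.commute)
  then have "norm c * infdist x R \<le> infdist (smul c x) R"
    using False by (simp add: le_divide_eq mult.commute)
  with le[OF False, of x] show ?thesis by linarith
qed

lemma infdist_subspace_translate:
  assumes "subspace R" "y - x \<in> R"
  shows "infdist y R = infdist x R"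
proof -
  have R: "R \<noteq> {}" using assms(2) by blast
  have le: "infdist v R \<le> infdist u R" if "v - u \<in> R" for u v
    unfolding infdist_notempty[OF R, of u]
  proof (rule cINF_greatest[OF R])
    fix a assume "a \<in> R"
    \<comment> \<open>Translation by \<open>v - u\<close> keeps \<open>R\<close> invariant and
      carries the pair \<open>u\<close>, \<open>a\<close> isometrically to \<open>v\<close>,
      \<open>a + (v - u)\<close>.\<close>
    then have "infdist v R \<le> dist v (a + (v - u))"
      using subspace_add[OF assms(1)] that by (intro infdist_le)
    then show "infdist v R \<le> dist u a" by (simp add: dist_norm)
  qed
  have "x - y \<in> R" using subspace_neg[OF assms] by simp
  with le assms(2) show ?thesis by (meson order_antisym)
qed

lemma subspace_ran_op_shift:
  assumes "linear_operator smul A"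
  shows "subspace (ran (op_shift smul A l))"
proof (rule subspaceI)
  have mem: "v \<in> ran (op_shift smul A l) \<longleftrightarrow> (\<exists>x y. A x = Some y \<and> v = y - smul l x)" for v
    unfolding ran_def op_shift_def by auto
  show "0 \<in> ran (op_shift smul A l)"
    using assms unfolding mem linear_operator_def by (metis diff_zero scale_zero_right)
  show "u + v \<in> ran (op_shift smul A l)"
    if uv: "u \<in> ran (op_shift smul A l)" "v \<in> ran (op_shift smul A l)" for u v
  proof -
    from uv obtain x y x' y' where *: "A x = Some y" "A x' = Some y'"
      "u = y - smul l x" "v = y' - smul l x'" unfolding mem by blast
    have "A (x + x') = Some (y + y')"
      using assms *(1,2) unfolding linear_operator_def by blast
    moreover have "u + v = (y + y') - smul l (x + x')"
      by (simp add: * scale_right_distrib)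
    ultimately show ?thesis unfolding mem by blast
  qed
  show "smul c u \<in> ran (op_shift smul A l)"
    if u: "u \<in> ran (op_shift smul A l)" for c u
  proof -
    from u obtain x y where *: "A x = Some y" "u = y - smul l x" unfolding mem by blast
    have "A (smul c x) = Some (smul c y)"
      using assms *(1) unfolding linear_operator_def by blast
    moreover have "smul c u = smul c y - smul l (smul c x)"
      by (simp add: * scale_right_diff_distrib mult.commute)
    ultimately show ?thesis unfolding mem by blast
  qed
qed

text \<open>Modulo the range of \<open>A - l I\<close>, the operator \<open>A\<close> acts as
  multiplication by \<open>l\<close>. Hence each application of \<open>A\<close> multiplies the
  distance to this range by \<open>norm l\<close>, and a dense orbit forces the distance to
  vanish.\<close>

lemma dense_range_op_shift:
  assumes lin: "linear_operator smul A" and "hypercyclic A"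
  shows "closure (ran (op_shift smul A l)) = UNIV"
proof -
  let ?R = "ran (op_shift smul A l)"
  have sub: "subspace ?R" using subspace_ran_op_shift[OF lin] .
  obtain f where f: "closure (op_orbit A f) = UNIV"
    using \<open>hypercyclic A\<close> unfolding hypercyclic_def by blast
  have "infdist x ?R = 0" for x
  proof (rule dense_orbit_scaled_eq_0[OF f, where p = "\<lambda>x. infdist x ?R" and c = "norm l"])
    show "continuous_on UNIV (\<lambda>x. infdist x ?R)"
      by (intro continuous_intros)
    show "infdist (r *\<^sub>R x) ?R = \<bar>r\<bar> * infdist x ?R" for r x
      using infdist_subspace_scale[OF sub, of "of_real r"] by (simp add: scale_of_real)
    show "infdist y ?R = norm l * infdist x ?R" if "A x = Some y" for x y
    proof -
      have "y - smul l x \<in> ?R" using that unfolding ran_def op_shift_def by auto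
      then have "infdist y ?R = infdist (smul l x) ?R"
        by (rule infdist_subspace_translate[OF sub])
      then show ?thesis by (simp add: infdist_subspace_scale[OF sub])
    qed
  qed (simp_all add: infdist_nonneg)
  \<comment> \<open>\<open>infdist\<close> to the empty set is 0 by convention, so zero distance
    yields membership in the closure only for a nonempty set.\<close>
  moreover have "?R \<noteq> {}" using subspace_0[OF sub] by blast
  ultimately show ?thesis by (metis UNIV_eq_I in_closure_iff_infdist_zero)
qed

end

theorem proposition4p1:
  fixes A :: "'x::banach \<rightharpoonup> 'x"
    and scaleC :: "complex \<Rightarrow> 'y::banach \<Rightarrow> 'y"
    and B :: "'y \<rightharpoonup> 'y"
  shows
    "(infinite_dimensional (scaleR :: real \<Rightarrow> 'x \<Rightarrow> 'x) \<and>
      separable_space (euclidean :: 'x topology) \<and>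
      linear_operator scaleR A \<and> densely_defined A \<and> closed_operator A \<and> hypercyclic A
      \<longrightarrow>
      (\<forall>g \<in> (\<Inter>n\<in>{1..}. dom (op_power (adjoint_operator scaleR A) n)).
         g \<noteq> 0 \<longrightarrow> \<not> bounded (op_orbit (adjoint_operator scaleR A) g)) \<and>
      (\<nexists>l::real. eigenvalue dual_scale (adjoint_operator scaleR A) l) \<and>
      (\<forall>l::real. closure (ran (op_shift scaleR A l)) = UNIV))
     \<and>
     (normed_space_over scaleC \<and> infinite_dimensional scaleC \<and>
      separable_space (euclidean :: 'y topology) \<and>
      linear_operator scaleC B \<and> densely_defined B \<and> closed_operator B \<and> hypercyclic B
      \<longrightarrow>
      (\<forall>g \<in> (\<Inter>n\<in>{1..}. dom (op_power (adjoint_operator scaleC B) n)).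
         g \<noteq> 0 \<longrightarrow> \<not> bounded (op_orbit (adjoint_operator scaleC B) g)) \<and>
      (\<nexists>l::complex. eigenvalue dual_scale (adjoint_operator scaleC B) l) \<and>
      point_spectrum dual_scale (adjoint_operator scaleC B) = {} \<and>
      (\<forall>l::complex. closure (ran (op_shift scaleC B l)) = UNIV) \<and>
      residual_spectrum scaleC B = {})"
proof (intro conjI impI; elim conjE)
  assume A: "densely_defined A" "hypercyclic A"
  show "\<forall>g \<in> (\<Inter>n\<in>{1..}. dom (op_power (adjoint_operator scaleR A) n)).
      g \<noteq> 0 \<longrightarrow> \<not> bounded (op_orbit (adjoint_operator scaleR A) g)"
    by (intro ballI impI adjoint_orbit_unbounded[OF A])
  show "\<nexists>l::real. eigenvalue dual_scale (adjoint_operator scaleR A) l"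
    by (rule notI, elim exE notE[OF adjoint_no_eigenvalue[OF A]])
next
  assume "linear_operator scaleR A" "hypercyclic A"
  \<comment> \<open>The real case is the instance of the locale with \<open>scaleR\<close> as scalar
    multiplication.\<close>
  then show "\<forall>l::real. closure (ran (op_shift scaleR A l)) = UNIV"
    by (intro allI normed_space_over.dense_range_op_shift[OF normed_space_over_scaleR])
next
  assume B: "densely_defined B" "hypercyclic B"
  show "\<forall>g \<in> (\<Inter>n\<in>{1..}. dom (op_power (adjoint_operator scaleC B) n)).
      g \<noteq> 0 \<longrightarrow> \<not> bounded (op_orbit (adjoint_operator scaleC B) g)"
    by (intro ballI impI adjoint_orbit_unbounded[OF B])
  show no_eigenvalue: "\<nexists>l::complex. eigenvalue dual_scale (adjoint_operator scaleC B) l"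
    by (rule notI, elim exE notE[OF adjoint_no_eigenvalue[OF B]])
  show "point_spectrum dual_scale (adjoint_operator scaleC B) = {}"
    using adjoint_point_spectrum_subset[OF B(1), of scaleC] no_eigenvalue by blast
next
  assume "normed_space_over scaleC" "linear_operator scaleC B" "hypercyclic B"
  then have range: "closure (ran (op_shift scaleC B l)) = UNIV" for l
    by (rule normed_space_over.dense_range_op_shift)
  then show "\<forall>l::complex. closure (ran (op_shift scaleC B l)) = UNIV" ..
  \<comment> \<open>A point of the residual spectrum would require a range that is not
    dense.\<close>
  show "residual_spectrum scaleC B = {}"
    unfolding residual_spectrum_def by (simp add: range)
qed

end
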